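(* Let $u=c/d$ and $r=a/b$ be positive rational numbers in lowest terms (with $a,b,c,d$ positive integers), and suppose that $d$ is even, $d\mid \operatorname{lcm}(b,2)$, and $u\leq r$. Then, for every integer $k\geq 1$, $$\mathcal{T}_{u,k}(q)\succeq_q \mathcal{T}_{r,k}(q).$$
   Context: For $n\ge 0$, $(z;q)_n:=\prod_{j=0}^{n-1}(1-zq^j)$, with $(z;q)_0:=1$. Let $\mathcal{P}:=\bigcup_{M\geq 1}\mathbb{Q}[[q^{1/M}]]$ be the directed union of the rings of fractional power series (exponents are nonnegative rationals with a common denominator). If $F(q)=\sum_{\alpha\in\frac1M\mathbb{Z}_{\ge0}}c(\alpha)q^\alpha\in\mathcal{P}$, its integer trace is $\operatorname{Tr}_{\mathbb{Z}}(F):=\sum_{n\geq 0}c(n)q^n\in\mathbb{Q}[[q]]$, the sum running over integers $n\ge 0$ (all terms with non-integer exponent are discarded). For a positive rational number $r$ and an integer $k\geq 0$, set $$G_{r,k}(q):=\frac{(q^{r+1};q)_k}{(q;q)_k}\in\mathcal{P},\qquad \mathcal{T}_{r,k}(q):=\operatorname{Tr}_{\mathbb{Z}}(G_{r,k}(q))\in\mathbb{Z}[[q]].$$ For $F,G\in\mathbb{Q}[[q]]$, write $F\succeq_q G$ if for every integer $n\geq 0$ the coefficient of $q^n$ in $F-G$ is $\geq 0$. *)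

theory Defs
  imports Complex_Main "HOL-Computational_Algebra.Formal_Power_Series"
begin

definition supp_denom :: "nat \<Rightarrow> (rat \<Rightarrow> rat) \<Rightarrow> bool" where
  "supp_denom M f \<longleftrightarrow> M \<ge> 1 \<and> (\<forall>\<alpha>. f \<alpha> \<noteq> 0 \<longrightarrow> (\<exists>n::nat. \<alpha> = of_nat n / of_nat M))"

text \<open>The directed union of the rings of power series in \<open>q\<close> to the power \<open>1/M\<close>, an element being
  represented by its coefficient function on rational exponents.\<close>

typedef frac_fps = "{f :: rat \<Rightarrow> rat. \<exists>M. supp_denom M f}"
  morphisms fcoeff Abs_frac_fps
proof -
  have "supp_denom 1 (\<lambda>_. 0)" by (simp add: supp_denom_def)
  then show ?thesis by blast
qed

setup_lifting type_definition_frac_fps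

lemma frac_fps_eqI: "(\<And>\<alpha>. fcoeff x \<alpha> = fcoeff y \<alpha>) \<Longrightarrow> x = y"
  by (metis ext fcoeff_inject)

lemma supp_denom_mult1:
  assumes "supp_denom M f" "N \<ge> 1"
  shows "supp_denom (M * N) f"
proof -
  have "\<exists>k::nat. of_nat n / of_nat M = (of_nat k / of_nat (M * N) :: rat)" for n
    using assms by (intro exI[of _ "n * N"]) (simp add: supp_denom_def)
  then show ?thesis
    using assms unfolding supp_denom_def by (metis mult_le_mono nat_mult_1)
qed

lemma supp_denom_mult2: "supp_denom M f \<Longrightarrow> N \<ge> 1 \<Longrightarrow> supp_denom (N * M) f"
  using supp_denom_mult1[of M f N] by (simp add: mult.commute)

lemma supp_denom_common:
  assumes "\<exists>M. supp_denom M f" "\<exists>M. supp_denom M g"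
  obtains M where "supp_denom M f" "supp_denom M g"
  using assms by (metis supp_denom_def supp_denom_mult1 supp_denom_mult2)

lemma supp_denom_combine:
  assumes "supp_denom M f" "supp_denom M g" "\<And>\<alpha>. f \<alpha> = 0 \<Longrightarrow> g \<alpha> = 0 \<Longrightarrow> h \<alpha> = 0"
  shows "supp_denom M h"
  using assms unfolding supp_denom_def by blast

lemma frac_fps_denom: "\<exists>M. supp_denom M (fcoeff x)"
  using fcoeff by auto

lemma supp_denom_pos: "supp_denom M f \<Longrightarrow> M > 0"
  by (simp add: supp_denom_def)

instantiation frac_fps :: "{zero, one, plus, minus, uminus, times}"
begin

lift_definition zero_frac_fps :: frac_fps is "\<lambda>_. 0"
  by (rule exI[of _ 1]) (simp add: supp_denom_def)

lift_definition one_frac_fps :: frac_fps is "\<lambda>\<alpha>. if \<alpha> = 0 then 1 else 0"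
  by (rule exI[of _ 1]) (auto simp: supp_denom_def intro!: exI[of _ "0::nat"])

lift_definition plus_frac_fps :: "frac_fps \<Rightarrow> frac_fps \<Rightarrow> frac_fps" is "\<lambda>f g \<alpha>. f \<alpha> + g \<alpha>"
  by (erule (1) supp_denom_common) (rule exI, erule (1) supp_denom_combine, simp)

lift_definition minus_frac_fps :: "frac_fps \<Rightarrow> frac_fps \<Rightarrow> frac_fps" is "\<lambda>f g \<alpha>. f \<alpha> - g \<alpha>"
  by (erule (1) supp_denom_common) (rule exI, erule (1) supp_denom_combine, simp)

lift_definition uminus_frac_fps :: "frac_fps \<Rightarrow> frac_fps" is "\<lambda>f \<alpha>. - f \<alpha>"
  by (auto simp: supp_denom_def)

text \<open>The index set is finite, see \<open>finite_mult_support\<close> below.\<close>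

lift_definition times_frac_fps :: "frac_fps \<Rightarrow> frac_fps \<Rightarrow> frac_fps" is
  "\<lambda>f g \<alpha>. \<Sum>\<beta> | f \<beta> \<noteq> 0 \<and> g (\<alpha> - \<beta>) \<noteq> 0. f \<beta> * g (\<alpha> - \<beta>)"
proof -
  fix f g :: "rat \<Rightarrow> rat"
  assume "\<exists>M. supp_denom M f" "\<exists>M. supp_denom M g"
  then obtain M where M: "supp_denom M f" "supp_denom M g"
    by (rule supp_denom_common)
  have "\<exists>n::nat. \<alpha> = of_nat n / of_nat M"
    if nz: "(\<Sum>\<beta> | f \<beta> \<noteq> 0 \<and> g (\<alpha> - \<beta>) \<noteq> 0. f \<beta> * g (\<alpha> - \<beta>)) \<noteq> 0" for \<alpha>
  proof -
    obtain \<beta> where "f \<beta> \<noteq> 0" "g (\<alpha> - \<beta>) \<noteq> 0"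
      using nz by (auto elim: sum.not_neutral_contains_not_neutral)
    then obtain m n :: nat where "\<beta> = of_nat m / of_nat M" "\<alpha> - \<beta> = of_nat n / of_nat M"
      using M unfolding supp_denom_def by blast
    then have "\<alpha> = of_nat (m + n) / of_nat M"
      by (simp add: add_divide_distrib algebra_simps)
    then show ?thesis by blast
  qed
  then show "\<exists>M. supp_denom M (\<lambda>\<alpha>. \<Sum>\<beta> | f \<beta> \<noteq> 0 \<and> g (\<alpha> - \<beta>) \<noteq> 0. f \<beta> * g (\<alpha> - \<beta>))"
    using M unfolding supp_denom_def by blast
qed

instance ..

end

lemma finite_mult_support:
  "finite {\<beta>. fcoeff x \<beta> \<noteq> 0 \<and> fcoeff y (\<alpha> - \<beta>) \<noteq> 0}"
proof -
  obtain M where M: "supp_denom M (fcoeff x)" "supp_denom M (fcoeff y)"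
    using supp_denom_common[OF frac_fps_denom frac_fps_denom] by blast
  have Mpos: "(of_nat M :: rat) > 0"
    using supp_denom_pos[OF M(1)] by simp
  have "{\<beta>. fcoeff x \<beta> \<noteq> 0 \<and> fcoeff y (\<alpha> - \<beta>) \<noteq> 0}
      \<subseteq> (\<lambda>n::nat. of_nat n / of_nat M) ` {.. nat \<lceil>\<alpha> * of_nat M\<rceil>}"
  proof
    fix \<beta> assume "\<beta> \<in> {\<beta>. fcoeff x \<beta> \<noteq> 0 \<and> fcoeff y (\<alpha> - \<beta>) \<noteq> 0}"
    then obtain m n :: nat where mn: "\<beta> = of_nat m / of_nat M" "\<alpha> - \<beta> = of_nat n / of_nat M"
      using M unfolding supp_denom_def by blast
    have "\<alpha> = of_nat n / of_nat M + of_nat m / of_nat M"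
      using mn by (metis diff_add_cancel)
    then have "\<alpha> * of_nat M = of_nat (m + n)"
      using Mpos by (simp add: field_simps)
    then have "m \<le> nat \<lceil>\<alpha> * of_nat M\<rceil>"
      by (simp only: ceiling_of_nat nat_int le_add1)
    then show "\<beta> \<in> (\<lambda>n::nat. of_nat n / of_nat M) ` {.. nat \<lceil>\<alpha> * of_nat M\<rceil>}"
      using mn by blast
  qed
  then show ?thesis
    by (rule finite_subset) simp
qed

text \<open>The embedding of the power series ring in one variable that sends the variable
  to \<open>q\<close> to the power \<open>1/M\<close>, for \<open>M > 0\<close>.\<close>

lift_definition of_fps :: "nat \<Rightarrow> rat fps \<Rightarrow> frac_fps" is
  "\<lambda>M f \<alpha>. if M > 0 \<and> (\<exists>n::nat. \<alpha> = of_nat n / of_nat M)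
            then fps_nth f (nat \<lfloor>\<alpha> * of_nat M\<rfloor>) else 0"
proof -
  fix M :: nat and f :: "rat fps"
  show "\<exists>N. supp_denom N (\<lambda>\<alpha>. if M > 0 \<and> (\<exists>n::nat. \<alpha> = of_nat n / of_nat M)
            then fps_nth f (nat \<lfloor>\<alpha> * of_nat M\<rfloor>) else 0)"
    by (rule exI[of _ "max 1 M"]) (auto simp: supp_denom_def max_def split: if_splits)
qed

lemma fcoeff_of_fps [simp]:
  "M > 0 \<Longrightarrow> fcoeff (of_fps M f) (of_nat n / of_nat M) = fps_nth f n"
  by (auto simp: of_fps.rep_eq)

lemma fcoeff_of_fps_eq_0:
  "(\<And>n::nat. \<alpha> \<noteq> of_nat n / of_nat M) \<Longrightarrow> fcoeff (of_fps M f) \<alpha> = 0"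
  by (simp add: of_fps.rep_eq)

lemma supp_denom_of_fps: "M > 0 \<Longrightarrow> supp_denom M (fcoeff (of_fps M f))"
  by (auto simp: supp_denom_def of_fps.rep_eq split: if_splits)

lemma ex_of_fps:
  assumes "supp_denom M (fcoeff x)"
  shows "\<exists>f. x = of_fps M f"
proof
  show "x = of_fps M (Abs_fps (\<lambda>n. fcoeff x (of_nat n / of_nat M)))" (is "_ = ?y")
  proof (rule frac_fps_eqI)
    fix \<alpha>
    show "fcoeff x \<alpha> = fcoeff ?y \<alpha>"
    proof (cases "\<exists>n::nat. \<alpha> = of_nat n / of_nat M")
      case True
      then show ?thesis using supp_denom_pos[OF assms] by auto
    next
      case False
      then have "fcoeff x \<alpha> = 0" using assms unfolding supp_denom_def by blast
      moreover have "fcoeff ?y \<alpha> = 0" using False by (intro fcoeff_of_fps_eq_0) blast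
      ultimately show ?thesis by simp
    qed
  qed
qed

lemma of_fps_inject: "M > 0 \<Longrightarrow> of_fps M f = of_fps M g \<longleftrightarrow> f = g"
  by (metis fcoeff_of_fps fps_ext)

lemma of_fps_eqI:
  assumes "M > 0" "supp_denom M (fcoeff x)"
    and "\<And>n. fcoeff x (of_nat n / of_nat M) = fps_nth f n"
  shows "of_fps M f = x"
proof -
  obtain g where g: "x = of_fps M g" using ex_of_fps[OF assms(2)] by blast
  have "f = g" using assms(3) fcoeff_of_fps[OF assms(1), of g] by (intro fps_ext) (simp add: g)
  then show ?thesis using g by simp
qed

lemma of_fps_0: "M > 0 \<Longrightarrow> of_fps M 0 = 0"
  by (rule of_fps_eqI, assumption) (simp_all add: zero_frac_fps.rep_eq supp_denom_def)

lemma of_fps_1: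
  assumes "M > 0"
  shows "of_fps M 1 = 1"
proof (rule of_fps_eqI[OF assms])
  show "supp_denom M (fcoeff 1)"
    using assms by (simp add: one_frac_fps.rep_eq supp_denom_def exI[of _ "0::nat"])
  show "fcoeff 1 (of_nat n / of_nat M) = fps_nth 1 n" for n
    using assms by (simp add: one_frac_fps.rep_eq)
qed

lemma of_fps_uminus:
  assumes "M > 0"
  shows "of_fps M (- f) = - of_fps M f"
proof (rule of_fps_eqI[OF assms])
  show "supp_denom M (fcoeff (- of_fps M f))"
    by (rule supp_denom_combine[OF supp_denom_of_fps[OF assms, of f] supp_denom_of_fps[OF assms, of f]])
      (simp add: uminus_frac_fps.rep_eq)
  show "fcoeff (- of_fps M f) (of_nat n / of_nat M) = fps_nth (- f) n" for n
    using assms by (simp add: uminus_frac_fps.rep_eq)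
qed

lemma of_fps_add:
  assumes "M > 0"
  shows "of_fps M (f + g) = of_fps M f + of_fps M g"
proof (rule of_fps_eqI[OF assms])
  show "supp_denom M (fcoeff (of_fps M f + of_fps M g))"
    by (rule supp_denom_combine[OF supp_denom_of_fps[OF assms, of f] supp_denom_of_fps[OF assms, of g]])
      (simp add: plus_frac_fps.rep_eq)
  show "fcoeff (of_fps M f + of_fps M g) (of_nat n / of_nat M) = fps_nth (f + g) n" for n
    using assms by (simp add: plus_frac_fps.rep_eq)
qed

lemma of_fps_diff:
  assumes "M > 0"
  shows "of_fps M (f - g) = of_fps M f - of_fps M g"
proof (rule of_fps_eqI[OF assms])
  show "supp_denom M (fcoeff (of_fps M f - of_fps M g))"
    by (rule supp_denom_combine[OF supp_denom_of_fps[OF assms, of f] supp_denom_of_fps[OF assms, of g]])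
      (simp add: minus_frac_fps.rep_eq)
  show "fcoeff (of_fps M f - of_fps M g) (of_nat n / of_nat M) = fps_nth (f - g) n" for n
    using assms by (simp add: minus_frac_fps.rep_eq)
qed

lemma of_fps_mult:
  assumes M: "M > 0"
  shows "of_fps M (f * g) = of_fps M f * of_fps M g"
proof (rule of_fps_eqI[OF M])
  let ?x = "fcoeff (of_fps M f)" and ?y = "fcoeff (of_fps M g)"
  have fin: "finite {\<beta>. ?x \<beta> \<noteq> 0 \<and> ?y (\<alpha> - \<beta>) \<noteq> 0}" for \<alpha>
    by (rule finite_mult_support)
  have rep: "\<beta> \<in> (\<lambda>i::nat. of_nat i / of_nat M) ` {..n}"
    if "?x \<beta> \<noteq> 0" "?y (of_nat n / of_nat M - \<beta>) \<noteq> 0" for \<beta> n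
  proof -
    obtain i j :: nat where ij: "\<beta> = of_nat i / of_nat M"
        "of_nat n / of_nat M - \<beta> = of_nat j / of_nat M"
      using \<open>?x \<beta> \<noteq> 0\<close> \<open>?y (of_nat n / of_nat M - \<beta>) \<noteq> 0\<close> supp_denom_of_fps[OF M] unfolding supp_denom_def by blast
    have "of_nat n / of_nat M = (of_nat j / of_nat M + of_nat i / of_nat M :: rat)"
      using ij by (metis diff_add_cancel)
    then have "(of_nat n :: rat) = of_nat (i + j)"
      using M by (simp add: field_simps)
    then have "i \<le> n" by (metis of_nat_eq_iff le_add1)
    then show ?thesis using ij by blast
  qed
  show "fcoeff (of_fps M f * of_fps M g) (of_nat n / of_nat M) = fps_nth (f * g) n" for n
  proof -
    have "fcoeff (of_fps M f * of_fps M g) (of_nat n / of_nat M)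
        = (\<Sum>\<beta> \<in> (\<lambda>i::nat. of_nat i / of_nat M) ` {..n}. ?x \<beta> * ?y (of_nat n / of_nat M - \<beta>))"
      unfolding times_frac_fps.rep_eq using rep by (intro sum.mono_neutral_left) auto
    also have "\<dots> = (\<Sum>i\<le>n. ?x (of_nat i / of_nat M) * ?y (of_nat n / of_nat M - of_nat i / of_nat M))"
      using M by (subst sum.reindex) (auto simp: inj_on_def)
    also have "\<dots> = (\<Sum>i\<le>n. fps_nth f i * fps_nth g (n - i))"
    proof (rule sum.cong)
      fix i assume "i \<in> {..n}"
      then have "of_nat n / of_nat M - of_nat i / of_nat M = (of_nat (n - i) / of_nat M :: rat)"
        by (simp add: of_nat_diff diff_divide_distrib)
      then show "?x (of_nat i / of_nat M) * ?y (of_nat n / of_nat M - of_nat i / of_nat M)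
          = fps_nth f i * fps_nth g (n - i)"
        using M by simp
    qed simp
    finally show ?thesis by (simp add: fps_mult_nth atLeast0AtMost)
  qed
  show "supp_denom M (fcoeff (of_fps M f * of_fps M g))"
    unfolding supp_denom_def
  proof (intro conjI allI impI)
    show "1 \<le> M" using M by simp
    fix \<alpha> assume "fcoeff (of_fps M f * of_fps M g) \<alpha> \<noteq> 0"
    then obtain \<beta> where "?x \<beta> \<noteq> 0" "?y (\<alpha> - \<beta>) \<noteq> 0"
      unfolding times_frac_fps.rep_eq
      by (auto elim: sum.not_neutral_contains_not_neutral)
    then obtain i j :: nat where ij: "\<beta> = of_nat i / of_nat M" "\<alpha> - \<beta> = of_nat j / of_nat M"
      using supp_denom_of_fps[OF M] unfolding supp_denom_def by blast
    then have "\<alpha> = of_nat (i + j) / of_nat M"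
      by (simp add: add_divide_distrib algebra_simps)
    then show "\<exists>n::nat. \<alpha> = of_nat n / of_nat M" by blast
  qed
qed

lemma of_fps_cases3:
  obtains M f g h where "M > 0" "x = of_fps M f" "y = of_fps M g" "z = of_fps M h"
proof -
  obtain N where N: "supp_denom N (fcoeff x)" "supp_denom N (fcoeff y)"
    using supp_denom_common[OF frac_fps_denom frac_fps_denom] by blast
  obtain L where L: "supp_denom L (fcoeff z)"
    using frac_fps_denom by blast
  have "N \<ge> 1" "L \<ge> 1" using N L by (simp_all add: supp_denom_def)
  then have "supp_denom (N * L) (fcoeff x)" "supp_denom (N * L) (fcoeff y)" "supp_denom (N * L) (fcoeff z)"
    using N L by (simp_all add: supp_denom_mult1 supp_denom_mult2)
  then show thesis
    using that ex_of_fps supp_denom_pos by metis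
qed

instance frac_fps :: comm_ring_1
proof
  fix x y z :: frac_fps
  obtain M f g h where M: "M > 0" and "x = of_fps M f" "y = of_fps M g" "z = of_fps M h"
    by (rule of_fps_cases3)
  note e = this(2-4) of_fps_0[OF M, symmetric] of_fps_1[OF M, symmetric]
    of_fps_add[OF M, symmetric] of_fps_diff[OF M, symmetric]
    of_fps_uminus[OF M, symmetric] of_fps_mult[OF M, symmetric]
  show "x * y * z = x * (y * z)" "x * y = y * x" "1 * x = x" "x + y + z = x + (y + z)"
    "x + y = y + x" "0 + x = x" "- x + x = 0" "x - y = x + - y" "(x + y) * z = x * z + y * z"
    unfolding e by (simp_all add: algebra_simps)
  show "(0::frac_fps) \<noteq> 1"
    unfolding e of_fps_inject[OF M] by simp
qed

text \<open>As usual in HOL, inversion is made total by a dummy value on non-units.\<close>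

instantiation frac_fps :: inverse
begin

definition inverse_frac_fps :: "frac_fps \<Rightarrow> frac_fps" where
  "inverse_frac_fps x = (if x dvd 1 then THE y. x * y = 1 else 0)"

definition divide_frac_fps :: "frac_fps \<Rightarrow> frac_fps \<Rightarrow> frac_fps" where
  "divide_frac_fps x y = x * inverse y"

instance ..

end

lemma inverse_frac_fps_unique:
  fixes x y :: frac_fps
  assumes "x * y = 1"
  shows "inverse x = y"
proof -
  have "(THE y. x * y = 1) = y"
  proof (rule the_equality)
    fix z assume "x * z = 1"
    then show "z = y" using assms by (metis mult.assoc mult.commute mult_1)
  qed (fact assms)
  moreover have "x dvd 1" using assms by (metis dvd_triv_left)
  ultimately show ?thesis by (simp add: inverse_frac_fps_def)
qed

lemma of_fps_inverse:
  assumes "M > 0" "fps_nth f 0 \<noteq> 0"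
  shows "inverse (of_fps M f) = of_fps M (inverse f)"
  by (rule inverse_frac_fps_unique)
    (metis assms mult.commute inverse_mult_eq_1 of_fps_1 of_fps_mult)

lemma frac_fps_right_inverse:
  assumes "fcoeff x 0 \<noteq> 0"
  shows "x * inverse x = 1"
proof -
  obtain M f where M: "M > 0" and x: "x = of_fps M f" by (rule of_fps_cases3)
  have "fps_nth f 0 \<noteq> 0" using assms fcoeff_of_fps[OF M, of f 0] x by simp
  then show ?thesis
    using M x by (metis of_fps_inverse mult.commute inverse_mult_eq_1 of_fps_1 of_fps_mult)
qed

text \<open>The monomial \<open>q\<close> to the power \<open>\<alpha>\<close>, where \<open>\<alpha> \<ge> 0\<close>; it is set to \<open>0\<close> for negative \<open>\<alpha>\<close>.\<close>

lift_definition qpow :: "rat \<Rightarrow> frac_fps" is "\<lambda>\<alpha> \<beta>. if \<alpha> \<ge> 0 \<and> \<beta> = \<alpha> then 1 else 0"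
proof -
  fix \<alpha> :: rat
  show "\<exists>M. supp_denom M (\<lambda>\<beta>. if \<alpha> \<ge> 0 \<and> \<beta> = \<alpha> then 1 else 0)"
  proof (cases "\<alpha> \<ge> 0")
    case True
    obtain a b where ab: "quotient_of \<alpha> = (a, b)" by force
    then have b: "b > 0" and eq: "\<alpha> = of_int a / of_int b"
      by (simp_all add: quotient_of_denom_pos quotient_of_div)
    have "a \<ge> 0" using True b eq by (simp add: zero_le_divide_iff)
    then have "\<alpha> = of_nat (nat a) / of_nat (nat b)" using b eq by simp
    then have "supp_denom (nat b) (\<lambda>\<beta>. if \<alpha> \<ge> 0 \<and> \<beta> = \<alpha> then 1 else 0)"
      using b unfolding supp_denom_def by auto
    then show ?thesis by blast
  qed (auto simp: supp_denom_def)
qed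

lemma of_fps_fps_X_power:
  assumes "M > 0"
  shows "of_fps M (fps_X ^ n) = qpow (of_nat n / of_nat M)"
  using assms by (intro of_fps_eqI[OF assms]) (simp_all add: qpow.rep_eq supp_denom_def, blast?)

lemma qpow_add: "\<alpha> \<ge> 0 \<Longrightarrow> \<beta> \<ge> 0 \<Longrightarrow> qpow (\<alpha> + \<beta>) = qpow \<alpha> * qpow \<beta>"
proof -
  assume nonneg: "\<alpha> \<ge> 0" "\<beta> \<ge> 0"
  obtain M f g where M: "M > 0" and f: "qpow \<alpha> = of_fps M f" and g: "qpow \<beta> = of_fps M g"
    by (rule of_fps_cases3)
  have "fcoeff (qpow \<alpha>) \<alpha> \<noteq> 0" "fcoeff (qpow \<beta>) \<beta> \<noteq> 0"
    using nonneg by (simp_all add: qpow.rep_eq)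
  then obtain m n :: nat where mn: "\<alpha> = of_nat m / of_nat M" "\<beta> = of_nat n / of_nat M"
    using supp_denom_of_fps[OF M, of f] supp_denom_of_fps[OF M, of g]
    unfolding f g supp_denom_def by blast
  have "\<alpha> + \<beta> = of_nat (m + n) / of_nat M" by (simp add: mn add_divide_distrib)
  then have "qpow (\<alpha> + \<beta>) = of_fps M (fps_X ^ m * fps_X ^ n)"
    by (simp only: of_fps_fps_X_power[OF M] flip: power_add)
  also have "\<dots> = qpow \<alpha> * qpow \<beta>"
    by (simp only: mn of_fps_mult[OF M] of_fps_fps_X_power[OF M])
  finally show ?thesis .
qed

definition qpochhammer :: "'a::comm_ring_1 \<Rightarrow> 'a \<Rightarrow> nat \<Rightarrow> 'a" where
  "qpochhammer z q n = (\<Prod>j<n. 1 - z * q ^ j)"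

definition int_trace :: "frac_fps \<Rightarrow> rat fps" where
  "int_trace F = Abs_fps (\<lambda>n. fcoeff F (of_nat n))"

definition G_series :: "rat \<Rightarrow> nat \<Rightarrow> frac_fps" where
  "G_series r k = qpochhammer (qpow (r + 1)) (qpow 1) k / qpochhammer (qpow 1) (qpow 1) k"

lemma qpochhammer_q_q_right_inverse:
  "qpochhammer (qpow 1) (qpow 1) k * inverse (qpochhammer (qpow 1) (qpow 1) k) = 1"
proof (rule frac_fps_right_inverse)
  have q: "qpow 1 = of_fps 1 fps_X" using of_fps_fps_X_power[of 1 1] by simp
  have pow: "of_fps 1 f ^ n = of_fps 1 (f ^ n)" for f n
    by (induction n) (simp_all only: power_0 power_Suc of_fps_1[OF zero_less_one] of_fps_mult[OF zero_less_one])
  have poch: "qpochhammer (of_fps 1 f) (of_fps 1 g) k = of_fps 1 (qpochhammer f g k)" for f g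
    unfolding qpochhammer_def
    by (induction k) (simp_all only: lessThan_0 prod.empty prod.lessThan_Suc pow
      of_fps_1[OF zero_less_one] of_fps_mult[OF zero_less_one] of_fps_diff[OF zero_less_one])
  have coeff0: "fps_nth (qpochhammer fps_X fps_X k) 0 = (1::rat)"
    unfolding qpochhammer_def by (induction k) (simp_all only: lessThan_0 prod.empty prod.lessThan_Suc
      fps_mult_nth_0 fps_sub_nth fps_one_nth fps_X_nth, simp_all)
  have "fcoeff (qpochhammer (qpow 1) (qpow 1) k) 0 = 1"
    using fcoeff_of_fps[OF zero_less_one, of "qpochhammer fps_X fps_X k" 0]
    by (simp only: q poch coeff0 of_nat_0 div_0)
  then show "fcoeff (qpochhammer (qpow 1) (qpow 1) k) 0 \<noteq> 0"
    by simp
qed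

definition T_series :: "rat \<Rightarrow> nat \<Rightarrow> rat fps" where
  "T_series r k = int_trace (G_series r k)"

definition coeff_ge :: "rat fps \<Rightarrow> rat fps \<Rightarrow> bool" (infix "\<succeq>\<^sub>q" 50) where
  "F \<succeq>\<^sub>q H \<longleftrightarrow> (\<forall>n. fps_nth (F - H) n \<ge> 0)"

end

(* The Rothe identity expands G_{r,k} as the sum over m of
   (-1)^m q^(m r + m + (m choose 2)) / ((q;q)_m (q;q)_{k-m}), so for r = a/b the integer trace keeps
   exactly the terms with b dvd m. For even d all terms of T_{u,k} are positive. A term of T_{r,k}
   with m odd is negative; if m is even then d divides lcm b 2, hence m, and the two terms of index m
   differ by a nonnegative series times (1 - q^N) / (q;q)_m with N = m r - m u, which has
   nonnegative coefficients because 1 - q divides 1 - q^N with nonnegative quotient. *)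
theory Submission
  imports Defs
begin

section \<open>The Rothe identity\<close>

lemma qpochhammer_0 [simp]: "qpochhammer z q 0 = 1"
  by (simp add: qpochhammer_def)

lemma qpochhammer_Suc: "qpochhammer z q (Suc n) = qpochhammer z q n * (1 - z * q ^ n)"
  by (simp add: qpochhammer_def)

(* The q-binomial coefficients are kept as products of the inverses H of (q;q)_m, so that the
   identity makes sense in any commutative ring. *)
lemma rothe_identity:
  fixes q z :: "'a::comm_ring_1"
  assumes H: "\<And>m. qpochhammer q q m * H m = 1"
  shows "qpochhammer q q k * (\<Sum>m\<le>k. (-1) ^ m * q ^ (m choose 2) * z ^ m * H m * H (k - m)) =
    qpochhammer z q k"
proof (induction k)
  case 0
  show ?case using H[of 0] by (simp add: numeral_2_eq_2)
next
  case (Suc k)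
  define S where "S k = (\<Sum>m\<le>k. (-1) ^ m * q ^ (m choose 2) * z ^ m * H m * H (k - m))" for k
  \<comment> \<open>No cancellation is available in a general ring, so the factor
    \<open>qpochhammer q q m * H m\<close> = 1 is inserted and regrouped.\<close>
  have H_Suc: "(1 - q ^ Suc m) * H (Suc m) = H m" for m
  proof -
    have "(1 - q ^ Suc m) * H (Suc m) = (qpochhammer q q m * H m) * ((1 - q ^ Suc m) * H (Suc m))"
      by (simp add: H)
    also have "\<dots> = H m * (qpochhammer q q (Suc m) * H (Suc m))"
      by (simp add: qpochhammer_Suc mult_ac)
    finally show ?thesis by (simp add: H)
  qed
  define A where "A m = (-1) ^ m * q ^ (m choose 2) * z ^ m" for m
  \<comment> \<open>The q-Pascal split: with n = k + 1, 1 - q^n = (1 - q^(n-m)) + q^(n-m) (1 - q^m).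
    By \<open>H_Suc\<close>, each half lowers the index of one of the two \<open>H\<close>
    factors.\<close>
  have "(1 - q ^ Suc k) * S (Suc k) =
      (\<Sum>m\<le>Suc k. A m * H m * ((1 - q ^ (Suc k - m)) * H (Suc k - m))
        + A m * q ^ (Suc k - m) * ((1 - q ^ m) * H m) * H (Suc k - m))"
    unfolding S_def sum_distrib_left
  proof (rule sum.cong[OF refl])
    fix m assume "m \<in> {..Suc k}"
    then have "q ^ Suc k = q ^ (Suc k - m) * q ^ m"
      by (simp flip: power_add)
    then show "(1 - q ^ Suc k) * ((-1) ^ m * q ^ (m choose 2) * z ^ m * H m * H (Suc k - m)) =
      A m * H m * ((1 - q ^ (Suc k - m)) * H (Suc k - m))
        + A m * q ^ (Suc k - m) * ((1 - q ^ m) * H m) * H (Suc k - m)"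
      unfolding A_def by (simp only:) (simp add: algebra_simps)
  qed
  also have "\<dots> = (\<Sum>m\<le>Suc k. A m * H m * ((1 - q ^ (Suc k - m)) * H (Suc k - m)))
      + (\<Sum>m\<le>Suc k. A m * q ^ (Suc k - m) * ((1 - q ^ m) * H m) * H (Suc k - m))"
    by (rule sum.distrib)
  \<comment> \<open>The top term m = k + 1 vanishes, since its factor is 1 - q^0.\<close>
  also have "(\<Sum>m\<le>Suc k. A m * H m * ((1 - q ^ (Suc k - m)) * H (Suc k - m))) = S k"
    unfolding S_def sum.atMost_Suc
    by (simp add: A_def Suc_diff_le H_Suc[unfolded power_Suc])
  \<comment> \<open>Here the term m = 0 vanishes for the same reason, and the index shifts down by
    one.\<close>
  also have "(\<Sum>m\<le>Suc k. A m * q ^ (Suc k - m) * ((1 - q ^ m) * H m) * H (Suc k - m)) =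
      (\<Sum>m\<le>k. A (Suc m) * q ^ (k - m) * H m * H (k - m))"
    unfolding sum.atMost_Suc_shift H_Suc by simp
  \<comment> \<open>The shift raises the binomial exponent by m, and q^m q^(k-m) = q^k no longer
    depends on m.\<close>
  also have "\<dots> = - (z * q ^ k * S k)"
    unfolding S_def sum_distrib_left sum_negf[symmetric]
  proof (rule sum.cong[OF refl])
    fix m assume "m \<in> {..k}"
    then have "q ^ k = q ^ m * q ^ (k - m)"
      by (simp flip: power_add)
    moreover have "Suc m choose 2 = m + (m choose 2)"
      by (simp add: numeral_2_eq_2)
    ultimately show "A (Suc m) * q ^ (k - m) * H m * H (k - m) =
      - (z * q ^ k * ((-1) ^ m * q ^ (m choose 2) * z ^ m * H m * H (k - m)))"
      by (simp add: A_def power_add mult_ac)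
  qed
  finally have step: "(1 - q ^ Suc k) * S (Suc k) = (1 - z * q ^ k) * S k"
    by (simp add: algebra_simps)
  have "qpochhammer q q (Suc k) * S (Suc k) = qpochhammer q q k * ((1 - q ^ Suc k) * S (Suc k))"
    by (simp add: qpochhammer_Suc mult_ac)
  also have "\<dots> = (1 - z * q ^ k) * (qpochhammer q q k * S k)"
    unfolding step by (simp add: mult_ac)
  finally have "qpochhammer q q (Suc k) * S (Suc k) = (1 - z * q ^ k) * (qpochhammer q q k * S k)" .
  with Suc show ?case
    by (simp add: S_def qpochhammer_Suc mult_ac)
qed

section \<open>Series with nonnegative coefficients\<close>

lemma coeff_ge_0_iff: "F \<succeq>\<^sub>q 0 \<longleftrightarrow> (\<forall>n. fps_nth F n \<ge> 0)"
  by (simp add: coeff_ge_def)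

lemma coeff_ge_0_zero: "0 \<succeq>\<^sub>q 0"
  by (simp add: coeff_ge_0_iff)

lemma coeff_ge_0_one: "1 \<succeq>\<^sub>q 0"
  by (simp add: coeff_ge_0_iff)

lemma coeff_ge_0_X_power: "fps_X ^ n \<succeq>\<^sub>q 0"
  by (simp add: coeff_ge_0_iff fps_X_power_iff)

lemma coeff_ge_0_mult: "F \<succeq>\<^sub>q 0 \<Longrightarrow> H \<succeq>\<^sub>q 0 \<Longrightarrow> F * H \<succeq>\<^sub>q 0"
  by (auto simp: coeff_ge_0_iff fps_mult_nth intro: sum_nonneg)

lemma coeff_ge_0_sum: "(\<And>i. i \<in> I \<Longrightarrow> F i \<succeq>\<^sub>q 0) \<Longrightarrow> (\<Sum>i\<in>I. F i) \<succeq>\<^sub>q 0"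
  by (auto simp: coeff_ge_0_iff fps_sum_nth intro: sum_nonneg)

lemma coeff_ge_0_prod: "(\<And>i. i \<in> I \<Longrightarrow> F i \<succeq>\<^sub>q 0) \<Longrightarrow> (\<Prod>i\<in>I. F i) \<succeq>\<^sub>q 0"
  by (induction I rule: infinite_finite_induct) (simp_all add: coeff_ge_0_one coeff_ge_0_mult)

text \<open>The inverse satisfies F = 1 + q^n F, so each coefficient is obtained from an earlier one
  by adding 0 or 1.\<close>

lemma coeff_ge_0_geometric:
  assumes "n > 0"
  shows "inverse (1 - fps_X ^ n) \<succeq>\<^sub>q 0"
proof -
  define F :: "rat fps" where "F = inverse (1 - fps_X ^ n)"
  have "F * (1 - fps_X ^ n) = 1"
    unfolding F_def using assms by (intro inverse_mult_eq_1) simp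
  then have F: "F = 1 + fps_X ^ n * F"
    by (simp add: algebra_simps)
  have "fps_nth F i \<ge> 0" for i
  proof (induction i rule: less_induct)
    case (less i)
    have "fps_nth F i = fps_nth (1 + fps_X ^ n * F) i"
      using F by simp
    also have "\<dots> \<ge> 0"
      using less assms by (simp add: fps_X_power_mult_nth)
    finally show ?case .
  qed
  then show ?thesis
    by (simp add: coeff_ge_0_iff F_def)
qed

text \<open>This is 1/(q;q)_m, the generating function of partitions into parts of size at most m.
  The product form gives nonnegativity factor by factor.\<close>

definition inv_qq :: "nat \<Rightarrow> rat fps" where
  "inv_qq m = (\<Prod>j<m. inverse (1 - fps_X ^ Suc j))"

lemma qpochhammer_inv_qq: "qpochhammer fps_X fps_X m * inv_qq m = 1"
  unfolding qpochhammer_def inv_qq_def prod.distrib[symmetric]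
proof (rule prod.neutral, rule ballI)
  fix j
  show "(1 - fps_X * fps_X ^ j) * inverse (1 - fps_X ^ Suc j) = (1 :: rat fps)"
    by (subst mult.commute, subst power_Suc, rule inverse_mult_eq_1) simp
qed

lemma coeff_ge_0_inv_qq: "inv_qq m \<succeq>\<^sub>q 0"
  unfolding inv_qq_def by (intro coeff_ge_0_prod coeff_ge_0_geometric) simp

lemma coeff_ge_0_one_minus_X_power_inv_qq:
  assumes "m > 0"
  shows "(1 - fps_X ^ N) * inv_qq m \<succeq>\<^sub>q 0"
proof -
  obtain l where l: "m = Suc l"
    using assms by (cases m) auto
  have "(1 - fps_X) * inverse (1 - fps_X) = (1 :: rat fps)"
    by (subst mult.commute, rule inverse_mult_eq_1) simp
  \<comment> \<open>Since m > 0, the product contains 1/(1 - q). Removing it leaves nonnegative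
    factors, and the freed 1 - q cancels in 1 - q^N = (1 - q)(1 + ... + q^(N-1)).\<close>
  then have "(1 - fps_X) * inv_qq m = (\<Prod>j<l. inverse (1 - fps_X ^ Suc (Suc j)))"
    unfolding inv_qq_def l prod.lessThan_Suc_shift by (simp add: mult.assoc[symmetric])
  then have "(1 - fps_X ^ N) * inv_qq m =
      (\<Sum>i<N. fps_X ^ i) * (\<Prod>j<l. inverse (1 - fps_X ^ Suc (Suc j)))"
    by (simp add: one_diff_power_eq mult_ac)
  also have "\<dots> \<succeq>\<^sub>q 0"
    by (intro coeff_ge_0_mult coeff_ge_0_sum coeff_ge_0_prod coeff_ge_0_geometric
        coeff_ge_0_X_power) simp
  finally show ?thesis .
qed

section \<open>Integer traces\<close>

lemma of_fps_power: "M > 0 \<Longrightarrow> of_fps M (f ^ n) = of_fps M f ^ n"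
  by (induction n) (simp_all add: of_fps_1 of_fps_mult)

lemma of_fps_qpochhammer:
  "M > 0 \<Longrightarrow> of_fps M (qpochhammer f g n) = qpochhammer (of_fps M f) (of_fps M g) n"
  by (induction n) (simp_all add: of_fps_1 of_fps_mult of_fps_diff of_fps_power qpochhammer_Suc)

lemma qpow_of_nat: "qpow (of_nat n) = of_fps 1 (fps_X ^ n)"
  using of_fps_fps_X_power[of 1 n] by simp

lemma qpow_power: "\<alpha> \<ge> 0 \<Longrightarrow> qpow \<alpha> ^ n = qpow (of_nat n * \<alpha>)"
proof (induction n)
  case 0
  show ?case using qpow_of_nat[of 0] by (simp add: of_fps_1)
next
  case (Suc n)
  then show ?case by (simp add: distrib_right qpow_add)
qed

lemma fcoeff_qpow_mult:
  assumes "\<alpha> \<ge> 0"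
  shows "fcoeff (qpow \<alpha> * x) \<beta> = fcoeff x (\<beta> - \<alpha>)"
proof -
  have "fcoeff (qpow \<alpha> * x) \<beta> = (\<Sum>\<gamma>\<in>{\<alpha>}. fcoeff (qpow \<alpha>) \<gamma> * fcoeff x (\<beta> - \<gamma>))"
    unfolding times_frac_fps.rep_eq
    by (rule sum.mono_neutral_left) (auto simp: qpow.rep_eq)
  with assms show ?thesis by (simp add: qpow.rep_eq)
qed

lemma int_trace_0: "int_trace 0 = 0"
  by (rule fps_ext) (simp add: int_trace_def zero_frac_fps.rep_eq)

lemma int_trace_add: "int_trace (x + y) = int_trace x + int_trace y"
  by (rule fps_ext) (simp add: int_trace_def plus_frac_fps.rep_eq)

lemma int_trace_sum: "int_trace (\<Sum>i\<in>I. f i) = (\<Sum>i\<in>I. int_trace (f i))"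
  by (induction I rule: infinite_finite_induct) (simp_all add: int_trace_0 int_trace_add)

lemma int_trace_of_fps: "int_trace (of_fps 1 f) = f"
proof (rule fps_ext)
  fix n show "fps_nth (int_trace (of_fps 1 f)) n = fps_nth f n"
    using fcoeff_of_fps[of 1 f n] by (simp add: int_trace_def)
qed

lemma int_trace_qpow_nat: "int_trace (qpow (of_nat N) * of_fps 1 f) = fps_X ^ N * f"
  by (simp add: qpow_of_nat int_trace_of_fps del: One_nat_def flip: of_fps_mult)

text \<open>Every exponent occurring in the product is \<alpha> plus a natural number, hence never
  an integer.\<close>

lemma int_trace_qpow_non_int:
  assumes "\<alpha> \<ge> 0" "\<alpha> \<notin> \<int>"
  shows "int_trace (qpow \<alpha> * of_fps 1 f) = 0"
proof (rule fps_ext)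
  fix n
  have "of_nat n - \<alpha> \<noteq> of_nat i / of_nat 1" for i
  proof
    assume "of_nat n - \<alpha> = of_nat i / of_nat 1"
    then have "\<alpha> = of_nat n - of_nat i" by simp
    then show False using assms(2) by simp
  qed
  then show "fps_nth (int_trace (qpow \<alpha> * of_fps 1 f)) n = fps_nth 0 n"
    using assms(1) by (simp add: int_trace_def fcoeff_qpow_mult fcoeff_of_fps_eq_0)
qed

text \<open>The Rothe identity at z = q^(r+1). Splitting z^m = q^(m r) q^m confines the fractional
  exponents to one monomial per term, so that the trace can be read off termwise.\<close>

lemma G_series_expansion:
  assumes "r \<ge> 0"
  shows "G_series r k = (\<Sum>m\<le>k. qpow (of_nat m * r) *
    of_fps 1 ((-1) ^ m * fps_X ^ (m + (m choose 2)) * inv_qq m * inv_qq (k - m)))"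
proof -
  let ?q = "of_fps 1 fps_X" and ?H = "\<lambda>m. of_fps 1 (inv_qq m)"
  have q: "qpow 1 = ?q"
    using qpow_of_nat[of 1] by simp
  have H: "qpochhammer ?q ?q m * ?H m = 1" for m
    by (simp add: qpochhammer_inv_qq of_fps_1 flip: of_fps_qpochhammer of_fps_mult)
  have z: "qpow (r + 1) ^ m = qpow (of_nat m * r) * ?q ^ m" for m
  proof -
    have "qpow (r + 1) ^ m = qpow r ^ m * qpow 1 ^ m"
      using assms by (simp add: qpow_add power_mult_distrib)
    then show ?thesis
      using assms by (simp add: qpow_power q)
  qed
  have "G_series r k = ?H k * qpochhammer (qpow (r + 1)) ?q k"
    by (simp only: G_series_def divide_frac_fps_def q inverse_frac_fps_unique[OF H] mult.commute)
  also have "\<dots> = (qpochhammer ?q ?q k * ?H k) *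
      (\<Sum>m\<le>k. (-1) ^ m * ?q ^ (m choose 2) * qpow (r + 1) ^ m * ?H m * ?H (k - m))"
    by (subst rothe_identity[OF H, where z = "qpow (r + 1)", symmetric]) (simp only: mult_ac)
  also have "\<dots> = (\<Sum>m\<le>k. qpow (of_nat m * r) *
      of_fps 1 ((-1) ^ m * fps_X ^ (m + (m choose 2)) * inv_qq m * inv_qq (k - m)))"
    unfolding H mult_1 by (simp add: z of_fps_mult of_fps_power of_fps_uminus of_fps_1 power_add mult_ac)
  finally show ?thesis .
qed

text \<open>In lowest terms, m a/b is an integer exactly when b divides m; all other terms have
  trace 0.\<close>

lemma T_series_expansion:
  fixes a b :: nat
  assumes "b > 0" "coprime a b"
  shows "T_series (of_nat a / of_nat b) k = (\<Sum>m\<le>k. (if b dvd m then fps_X ^ (m div b * a) else 0) *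
    ((-1) ^ m * fps_X ^ (m + (m choose 2)) * inv_qq m * inv_qq (k - m)))"
  unfolding T_series_def
proof (subst G_series_expansion, simp, subst int_trace_sum, rule sum.cong[OF refl])
  fix m
  let ?\<alpha> = "of_nat m * (of_nat a / of_nat b) :: rat"
    and ?f = "(-1) ^ m * fps_X ^ (m + (m choose 2)) * inv_qq m * inv_qq (k - m)"
  show "int_trace (qpow ?\<alpha> * of_fps 1 ?f) = (if b dvd m then fps_X ^ (m div b * a) else 0) * ?f"
  proof (cases "b dvd m")
    case True
    then obtain l where "m = b * l" ..
    with assms have "?\<alpha> = of_nat (m div b * a)" by simp
    with True show ?thesis by (simp only: int_trace_qpow_nat if_True)
  next
    case False
    have "?\<alpha> \<notin> \<int>"
    proof
      assume "?\<alpha> \<in> \<int>"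
      then obtain i where "?\<alpha> = of_int i" by (auto elim: Ints_cases)
      then have "(of_nat (m * a) :: rat) = of_int (i * int b)"
        using assms(1) by (simp add: field_simps)
      then have "int (m * a) = i * int b"
        by (metis of_int_eq_iff of_int_of_nat_eq)
      then have "b dvd m * a"
        by (metis dvd_triv_right int_dvd_int_iff)
      with assms(2) False show False
        by (simp add: coprime_commute coprime_dvd_mult_left_iff)
    qed
    with False show ?thesis
      by (simp add: int_trace_qpow_non_int del: One_nat_def times_divide_eq_right)
  qed
qed

section \<open>Termwise comparison of the two traces\<close>

theorem theorem1p3:
  fixes a b c d :: nat and u r :: rat
  assumes "a > 0" "b > 0" "c > 0" "d > 0"
    and "u = of_nat c / of_nat d" "coprime c d"
    and "r = of_nat a / of_nat b" "coprime a b"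
    and "even d"
    and "d dvd lcm b 2"
    and "u \<le> r"
  shows "\<forall>k\<ge>1. T_series u k \<succeq>\<^sub>q T_series r k"
proof (intro allI impI)
  fix k :: nat
  define K where "K m = fps_X ^ (m + (m choose 2)) * inv_qq m * inv_qq (k - m)" for m
  define U where "U m = (if d dvd m then fps_X ^ (m div d * c) else 0 :: rat fps)" for m
  define R where "R m = (if b dvd m then fps_X ^ (m div b * a) else 0 :: rat fps)" for m
  have K: "K m \<succeq>\<^sub>q 0" for m
    unfolding K_def by (intro coeff_ge_0_mult coeff_ge_0_X_power coeff_ge_0_inv_qq)
  have U: "U m \<succeq>\<^sub>q 0" and R: "R m \<succeq>\<^sub>q 0" for m
    by (simp_all add: U_def R_def coeff_ge_0_X_power coeff_ge_0_zero)
  have U_sign: "U m * (-1) ^ m = U m" for m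
    using \<open>even d\<close> by (auto simp: U_def)
  have "T_series u k - T_series r k = (\<Sum>m\<le>k. U m * K m - R m * ((-1) ^ m * K m))"
    unfolding \<open>u = _\<close> \<open>r = _\<close> T_series_expansion[OF \<open>d > 0\<close> \<open>coprime c d\<close>]
      T_series_expansion[OF \<open>b > 0\<close> \<open>coprime a b\<close>] sum_subtractf[symmetric]
    by (rule sum.cong[OF refl], subst U_sign[symmetric]) (simp add: U_def R_def K_def mult_ac)
  also have "\<dots> \<succeq>\<^sub>q 0"
  proof (rule coeff_ge_0_sum)
    fix m
    \<comment> \<open>The index m = 0 is separate because \<open>inv_qq 0\<close> has no factor 1/(1
      - q); there both terms equal \<open>K 0\<close> and cancel. If b does not divide m, only the
      nonnegative \<open>U\<close> term can survive.\<close>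
    consider "odd m" | "\<not> b dvd m" | "m = 0" | "even m" "b dvd m" "m > 0"
      by blast
    then show "U m * K m - R m * ((-1) ^ m * K m) \<succeq>\<^sub>q 0"
    proof cases
      case 1
      have "U m * K m \<succeq>\<^sub>q 0" "R m * K m \<succeq>\<^sub>q 0"
        by (intro coeff_ge_0_mult U R K)+
      with 1 show ?thesis by (simp add: coeff_ge_0_iff)
    next
      case 2
      then show ?thesis by (simp add: R_def coeff_ge_0_mult U K)
    next
      case 3
      then show ?thesis by (simp add: U_def R_def coeff_ge_0_zero)
    next
      case 4
      \<comment> \<open>Both b and 2 divide m, hence so does their lcm, of which d is a divisor.
        Thus the negative contribution of \<open>R m\<close> is always matched by a nonzero
        \<open>U m\<close>.\<close>
      have "d dvd m"
        using 4 \<open>d dvd lcm b 2\<close> by (meson dvd_trans lcm_least)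
      then have "of_nat (m div d * c) = of_nat m * u" "of_nat (m div b * a) = of_nat m * r"
        using 4 \<open>b > 0\<close> \<open>d > 0\<close> by (auto simp: \<open>u = _\<close> \<open>r = _\<close>)
      then have "(of_nat (m div d * c) :: rat) \<le> of_nat (m div b * a)"
        using \<open>u \<le> r\<close> by (simp only: mult_left_mono of_nat_0_le_iff)
      \<comment> \<open>The natural number N is m (r - u), nonnegative because u \<le> r.\<close>
      then obtain N where N: "m div b * a = m div d * c + N"
        by (metis le_Suc_ex of_nat_le_iff)
      have "U m * K m - R m * ((-1) ^ m * K m) = fps_X ^ (m div d * c) *
          (fps_X ^ (m + (m choose 2)) * (((1 - fps_X ^ N) * inv_qq m) * inv_qq (k - m)))"
        unfolding U_def R_def K_def N using 4 \<open>d dvd m\<close> by (simp add: N power_add algebra_simps)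
      also have "\<dots> \<succeq>\<^sub>q 0"
        by (intro coeff_ge_0_mult coeff_ge_0_X_power coeff_ge_0_inv_qq
            coeff_ge_0_one_minus_X_power_inv_qq) (fact 4)
      finally show ?thesis .
    qed
  qed
  finally show "T_series u k \<succeq>\<^sub>q T_series r k"
    by (simp add: coeff_ge_def)
qed

end
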